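(* The ordinary generating function, with respect to length, of the set $\mathcal{H}$ is $$B(x)=\frac{1-x^3-\sqrt{x^6-2x^3-4x^2+1}}{2x^2},$$ where the square root is the formal power series with constant term $1$.
   Context: A Dyck path with air pockets (DAP) is a nonempty lattice path starting at $(0,0)$, ending on the $x$-axis, never going below the $x$-axis, consisting of up-steps $U=(1,1)$ and down-steps $D_k=(1,-k)$ with $k\ge 1$, such that no two down-steps are consecutive; $D$ denotes $D_1$. A DAP is prime if it ends with a step $D_k$ with $k\ge 2$ and touches the $x$-axis only at its endpoints; let $\mathcal{P}$ be the set of prime DAP. The lowering $\alpha^\flat$ of a prime DAP $\alpha=U\beta' UD_k$ ($k\ge 2$) is the DAP $\beta' UD_{k-1}$. For a path $\gamma$, $h(\gamma)$ denotes the maximal ordinate reached by $\gamma$ ($h(\varepsilon)=0$). The set $\mathcal{H}$ is defined recursively as the union of the empty path and all DAP $\gamma$ whose first return decomposition $\gamma=\alpha\beta$ (where $\alpha$ is the prefix of $\gamma$ up to its first return to the $x$-axis, so $\alpha\in\mathcal{P}\cup\{UD\}$) satisfies: $\alpha^\flat\in\mathcal{H}$ whenever $\alpha\neq UD$, $\beta\in\mathcal{H}$, and $h(\alpha)\ge h(\beta)$. The length of a path is its number of steps. *)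

theory Defs
  imports Complex_Main "HOL-Computational_Algebra.Computational_Algebra"
begin

text \<open>\<open>Up\<close> is the step \<open>U = (1,1)\<close> and \<open>Down k\<close> is \<open>D\<^sub>k = (1,-k)\<close>; the side condition \<open>k \<ge> 1\<close>
  is imposed in \<open>dap\<close>.  A path starting at the origin is the list of its steps, and its length
  is the length of that list.\<close>

datatype step = Up | Down nat

type_synonym path = "step list"

fun rise :: "step \<Rightarrow> int" where
  "rise Up = 1"
| "rise (Down k) = - int k"

definition ordinate :: "path \<Rightarrow> nat \<Rightarrow> int" where
  "ordinate \<gamma> i = (\<Sum>s\<leftarrow>take i \<gamma>. rise s)"

definition is_down :: "step \<Rightarrow> bool" where
  "is_down s \<longleftrightarrow> (\<exists>k. s = Down k)"

definition dap :: "path \<Rightarrow> bool" where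
  "dap \<gamma> \<longleftrightarrow>
     \<gamma> \<noteq> [] \<and>
     (\<forall>k. Down k \<in> set \<gamma> \<longrightarrow> k \<ge> 1) \<and>
     ordinate \<gamma> (length \<gamma>) = 0 \<and>
     (\<forall>i\<le>length \<gamma>. ordinate \<gamma> i \<ge> 0) \<and>
     (\<forall>i. Suc i < length \<gamma> \<longrightarrow> \<not> (is_down (\<gamma> ! i) \<and> is_down (\<gamma> ! Suc i)))"

definition prime_daps :: "path set" where
  "prime_daps = {\<alpha>. dap \<alpha> \<and> (\<exists>k\<ge>2. last \<alpha> = Down k) \<and>
                    (\<forall>i. 0 < i \<and> i < length \<alpha> \<longrightarrow> ordinate \<alpha> i \<noteq> 0)}"

definition height :: "path \<Rightarrow> int" where
  "height \<gamma> = Max (ordinate \<gamma> ` {0..length \<gamma>})"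

fun lower_step :: "step \<Rightarrow> step" where
  "lower_step Up = Up"
| "lower_step (Down k) = Down (k - 1)"

text \<open>Only meaningful on \<open>prime_daps\<close>, where \<open>lowering_eq\<close> and \<open>prime_dap_shape\<close> below apply.\<close>

definition lowering :: "path \<Rightarrow> path" where
  "lowering \<alpha> = butlast (tl \<alpha>) @ [lower_step (last \<alpha>)]"

definition first_return :: "path \<Rightarrow> path" where
  "first_return \<gamma> = take (LEAST i. 0 < i \<and> ordinate \<gamma> i = 0) \<gamma>"

text \<open>In the rule \<open>step\<close>, \<open>\<alpha>\<close> is automatically \<open>[Up, Down 1]\<close> or a member of \<open>prime_daps\<close>
  (lemma \<open>first_return_cases\<close>), so \<open>lowering\<close> is only applied to prime paths.\<close>

inductive_set H_paths :: "path set" where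
  empty: "[] \<in> H_paths"
| step: "\<lbrakk>dap \<gamma>; \<alpha> = first_return \<gamma>; \<gamma> = \<alpha> @ \<beta>;
          \<alpha> \<noteq> [Up, Down 1] \<longrightarrow> lowering \<alpha> \<in> H_paths;
          \<beta> \<in> H_paths; height \<alpha> \<ge> height \<beta>\<rbrakk> \<Longrightarrow> \<gamma> \<in> H_paths"

text \<open>The coefficients below are cardinalities of finite sets by \<open>finite_H_paths_length\<close>.\<close>

definition H_gf :: "real fps" where
  "H_gf = Abs_fps (\<lambda>n. real (card {\<gamma> \<in> H_paths. length \<gamma> = n}))"

text \<open>\<open>fps_radical root 2\<close> takes the real square root of the constant term.\<close>

definition sqrt_series :: "real fps" where
  "sqrt_series = fps_radical root 2 (fps_X ^ 6 - 2 * fps_X ^ 3 - 4 * fps_X ^ 2 + 1)"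

lemma sqrt_series_nth_0: "fps_nth sqrt_series 0 = 1"
  by (simp add: sqrt_series_def numeral_fps_const)

lemma sqrt_series_power2: "sqrt_series ^ 2 = fps_X ^ 6 - 2 * fps_X ^ 3 - 4 * fps_X ^ 2 + 1"
proof -
  let ?f = "fps_X ^ 6 - 2 * fps_X ^ 3 - 4 * fps_X ^ 2 + 1 :: real fps"
  have "fps_nth ?f 0 = 1"
    by (simp add: numeral_fps_const)
  then show ?thesis
    using power_radical[of ?f root 1] by (simp add: sqrt_series_def numeral_2_eq_2)
qed

lemma lowering_eq: "lowering (Up # \<beta> @ [Up, Down k]) = \<beta> @ [Up, Down (k - 1)]"
  by (simp add: lowering_def butlast_append)

lemma ordinate_0 [simp]: "ordinate \<gamma> 0 = 0"
  by (simp add: ordinate_def)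

lemma ordinate_Suc:
  "i < length \<gamma> \<Longrightarrow> ordinate \<gamma> (Suc i) = ordinate \<gamma> i + rise (\<gamma> ! i)"
  by (simp add: ordinate_def take_Suc_conv_app_nth)

lemma ordinate_take: "i \<le> n \<Longrightarrow> ordinate (take n \<gamma>) i = ordinate \<gamma> i"
  by (simp add: ordinate_def min_def)

lemma ordinate_le: "ordinate \<gamma> i \<le> int i"
proof (induction i)
  case (Suc i)
  show ?case
  proof (cases "i < length \<gamma>")
    case True
    then show ?thesis using Suc ordinate_Suc[OF True] by (cases "\<gamma> ! i") auto
  next
    case False
    then have "ordinate \<gamma> (Suc i) = ordinate \<gamma> i" by (simp add: ordinate_def)
    then show ?thesis using Suc by simp
  qed
qed simp

lemma dap_hd:
  assumes "dap \<gamma>"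
  shows "\<gamma> ! 0 = Up"
proof (rule ccontr)
  assume "\<gamma> ! 0 \<noteq> Up"
  then obtain k where k: "\<gamma> ! 0 = Down k" by (cases "\<gamma> ! 0") auto
  have ne: "0 < length \<gamma>" using assms by (simp add: dap_def)
  then have "Down k \<in> set \<gamma>" using k nth_mem by metis
  then have "k \<ge> 1" using assms by (simp add: dap_def)
  moreover have "ordinate \<gamma> (Suc 0) \<ge> 0" using assms ne unfolding dap_def by (metis Suc_leI)
  ultimately show False using ordinate_Suc[OF ne] k by simp
qed

lemma dap_shape:
  assumes "dap \<alpha>" and "length \<alpha> \<ge> 3"
  shows "\<exists>\<beta> k. \<alpha> = Up # \<beta> @ [Up, Down k]"
proof -
  obtain n where n: "length \<alpha> = Suc (Suc (Suc n))"
    using assms(2) by (metis add_2_eq_Suc le_Suc_ex numeral_3_eq_3 add_Suc)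
  have l: "ordinate \<alpha> (Suc (Suc (Suc n))) = ordinate \<alpha> (Suc (Suc n)) + rise (\<alpha> ! Suc (Suc n))"
    by (rule ordinate_Suc) (simp add: n)
  have "ordinate \<alpha> (Suc (Suc n)) \<ge> 0" "ordinate \<alpha> (Suc (Suc (Suc n))) = 0"
    using assms(1) n by (auto simp: dap_def)
  with l obtain k where k: "\<alpha> ! Suc (Suc n) = Down k" by (cases "\<alpha> ! Suc (Suc n)") auto
  have "\<not> (is_down (\<alpha> ! Suc n) \<and> is_down (\<alpha> ! Suc (Suc n)))"
    using assms(1) n by (simp add: dap_def)
  with k have u: "\<alpha> ! Suc n = Up" by (cases "\<alpha> ! Suc n") (auto simp: is_down_def)
  have "\<alpha> = Up # take n (tl \<alpha>) @ [Up, Down k]"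
  proof (rule nth_equalityI)
    show "length \<alpha> = length (Up # take n (tl \<alpha>) @ [Up, Down k])" using n by simp
  next
    fix i assume i: "i < length \<alpha>"
    show "\<alpha> ! i = (Up # take n (tl \<alpha>) @ [Up, Down k]) ! i"
      using i n k u dap_hd[OF assms(1)]
      by (cases i) (auto simp: nth_append nth_tl min_def less_Suc_eq)
  qed
  then show ?thesis by blast
qed

lemma prime_dap_shape:
  assumes "\<alpha> \<in> prime_daps"
  shows "\<exists>\<beta> k. k \<ge> 2 \<and> \<alpha> = Up # \<beta> @ [Up, Down k]"
proof -
  have d: "dap \<alpha>" using assms by (simp add: prime_daps_def)
  obtain k where k: "k \<ge> 2" "last \<alpha> = Down k" using assms by (auto simp: prime_daps_def)
  have ne: "\<alpha> \<noteq> []" using d by (simp add: dap_def)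
  define m where "m = length \<alpha> - 1"
  have m: "length \<alpha> = Suc m" using ne by (simp add: m_def)
  have lm: "\<alpha> ! m = Down k" using k ne by (simp add: m_def last_conv_nth)
  have "ordinate \<alpha> (Suc m) = ordinate \<alpha> m + rise (\<alpha> ! m)"
    by (rule ordinate_Suc) (simp add: m)
  moreover have "ordinate \<alpha> (Suc m) = 0" using d m by (simp add: dap_def)
  ultimately have "ordinate \<alpha> m = int k" using lm by simp
  with ordinate_le[of \<alpha> m] k have "m \<ge> 2" by simp
  then have "length \<alpha> \<ge> 3" using m by simp
  from dap_shape[OF d this] k show ?thesis by auto
qed

lemma first_return_cases:
  assumes "dap \<gamma>"
  shows "first_return \<gamma> \<in> prime_daps \<union> {[Up, Down 1]}"
proof -
  define P where "P = (\<lambda>i. 0 < i \<and> ordinate \<gamma> i = 0)"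
  define n where "n = (LEAST i. P i)"
  have len: "P (length \<gamma>)" using assms by (simp add: dap_def P_def)
  have Pn: "P n" unfolding n_def using len by (rule LeastI)
  have nl: "n \<le> length \<gamma>" unfolding n_def using len by (rule Least_le)
  have least: "\<not> P i" if "i < n" for i using that not_less_Least unfolding n_def by blast
  let ?a = "take n \<gamma>"
  have fr: "first_return \<gamma> = ?a" by (simp add: first_return_def n_def P_def)
  have la: "length ?a = n" using nl by simp
  have n0: "n > 0" using Pn by (simp add: P_def)
  have d: "dap ?a"
    unfolding dap_def la
  proof (intro conjI allI impI)
    show "?a \<noteq> []" using n0 nl by auto
    show "k \<ge> 1" if "Down k \<in> set ?a" for k
      using assms in_set_takeD[OF that] by (simp add: dap_def)
    show "ordinate ?a n = 0" using Pn by (simp add: ordinate_take P_def)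
    show "ordinate ?a i \<ge> 0" if "i \<le> n" for i
      using that nl assms by (simp add: ordinate_take dap_def)
    show "\<not> (is_down (?a ! i) \<and> is_down (?a ! Suc i))" if "Suc i < n" for i
      using that nl assms by (simp add: dap_def)
  qed
  have nz: "ordinate ?a i \<noteq> 0" if "0 < i" "i < length ?a" for i
    using that least[of i] la by (simp add: ordinate_take P_def)
  show ?thesis
  proof (cases "\<exists>k\<ge>2. last ?a = Down k")
    case True
    then show ?thesis using d nz fr by (simp add: prime_daps_def)
  next
    case False
    obtain m where m: "n = Suc m" using n0 by (cases n) auto
    have l: "last ?a = ?a ! m" using la m by (metis d dap_def diff_Suc_1 last_conv_nth)
    have o: "ordinate ?a (Suc m) = ordinate ?a m + rise (?a ! m)"
      by (rule ordinate_Suc) (use la m in simp)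
    have z: "ordinate ?a (Suc m) = 0" using d la m by (simp add: dap_def)
    have ge: "ordinate ?a m \<ge> 0" using d la m by (simp add: dap_def)
    obtain k where k: "?a ! m = Down k" using o z ge by (cases "?a ! m") auto
    have "Down k \<in> set ?a" using k la m by (metis lessI nth_mem)
    then have "k \<ge> 1" using d by (simp add: dap_def)
    moreover have "\<not> k \<ge> 2" using False k l by auto
    ultimately have k1: "k = 1" by simp
    then have om: "ordinate ?a m = 1" using o z k by simp
    have "length ?a < 3"
    proof (rule ccontr)
      assume "\<not> ?thesis"
      then have n3: "length ?a \<ge> 3" by linarith
      then obtain \<beta> k' where s: "?a = Up # \<beta> @ [Up, Down k']" using dap_shape[OF d] by blast
      have mm: "m = Suc (Suc (length \<beta>))" using arg_cong[OF s, of length] la m by simp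
      have "ordinate ?a m = ordinate ?a (Suc (length \<beta>)) + rise (?a ! Suc (length \<beta>))"
        unfolding mm by (rule ordinate_Suc) (use la m mm in simp)
      moreover have "?a ! Suc (length \<beta>) = Up" by (subst s) simp
      ultimately have "ordinate ?a (Suc (length \<beta>)) = 0" using om by simp
      moreover have "Suc (length \<beta>) < length ?a" using la m mm by linarith
      ultimately show False using nz[OF zero_less_Suc] by blast
    qed
    moreover have "m \<noteq> 0" using om by (cases m) auto
    ultimately have m1: "m = 1" using la m by simp
    have "?a = [Up, Down 1]"
    proof (rule nth_equalityI)
      show "length ?a = length [Up, Down 1]" using la m m1 by simp
      show "?a ! i = [Up, Down 1] ! i" if "i < length ?a" for i
      proof (cases i)
        case 0
        then show ?thesis using dap_hd[OF d] by (simp del: nth_take take_eq_Nil)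
      next
        case (Suc j)
        then have "i = m" using that la m m1 by linarith
        then show ?thesis using k k1 m1 by (simp del: nth_take)
      qed
    qed
    then show ?thesis using fr by simp
  qed
qed

lemma dap_steps:
  assumes "dap \<gamma>"
  shows "set \<gamma> \<subseteq> insert Up (Down ` {..length \<gamma>})"
proof
  fix s assume "s \<in> set \<gamma>"
  then obtain i where i: "i < length \<gamma>" "\<gamma> ! i = s" by (auto simp: in_set_conv_nth)
  have "ordinate \<gamma> (Suc i) \<ge> 0" using assms i by (simp add: dap_def)
  then have "ordinate \<gamma> i + rise s \<ge> 0" using ordinate_Suc[OF i(1)] i(2) by simp
  then show "s \<in> insert Up (Down ` {..length \<gamma>})"
    using ordinate_le[of \<gamma> i] i(1) by (cases s) auto
qed

lemma dap_H_paths: "\<gamma> \<in> H_paths \<Longrightarrow> \<gamma> \<noteq> [] \<Longrightarrow> dap \<gamma>"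
  by (erule H_paths.cases) blast+

lemma finite_H_paths_length: "finite {\<gamma> \<in> H_paths. length \<gamma> = n}"
proof (rule finite_subset)
  show "{\<gamma> \<in> H_paths. length \<gamma> = n}
        \<subseteq> {\<gamma>. set \<gamma> \<subseteq> insert Up (Down ` {..n}) \<and> length \<gamma> = n}"
  proof
    fix \<gamma> assume "\<gamma> \<in> {\<gamma> \<in> H_paths. length \<gamma> = n}"
    then have g: "\<gamma> \<in> H_paths" "length \<gamma> = n" by simp_all
    have "set \<gamma> \<subseteq> insert Up (Down ` {..n})"
    proof (cases "\<gamma> = []")
      case False
      then show ?thesis using dap_steps[OF dap_H_paths[OF g(1)]] g(2) by blast
    qed simp
    then show "\<gamma> \<in> {\<gamma>. set \<gamma> \<subseteq> insert Up (Down ` {..n}) \<and> length \<gamma> = n}"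
      using g(2) by blast
  qed
  show "finite {\<gamma>. set \<gamma> \<subseteq> insert Up (Down ` {..n}) \<and> length \<gamma> = n}"
    by (rule finite_lists_length_eq) simp
qed

end

theory Submission
  imports Defs
begin

text \<open>
  Lowering is inverted by \<open>lift\<close> below, so a nonempty path of \<open>\<H>\<close> is uniquely \<open>lift \<delta> @ \<beta>\<close> with
  \<open>\<delta>, \<beta> \<in> \<H>\<close> and \<open>h(\<beta>) \<le> h(\<delta>) + 1 = h(lift \<delta> @ \<beta>)\<close>.  Let \<open>A\<^sub>k\<close> and \<open>B\<^sub>k\<close> be the generating
  functions of the paths in \<open>\<H>\<close> of height equal to \<open>k\<close> and at most \<open>k\<close>.  Then \<open>A\<^sub>1 = x\<^sup>2 B\<^sub>1\<close> and
  \<open>A\<^sub>k = x A\<^sub>k\<^sub>-\<^sub>1 B\<^sub>k\<close> for \<open>k \<ge> 2\<close>.  This recurrence conserves \<open>1 / B\<^sub>k\<^sub>+\<^sub>2 + x\<^sup>2 B\<^sub>k\<close>, which is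
  \<open>1 - x\<^sup>3\<close> for \<open>k = 0\<close>; in the limit \<open>B (1 - x\<^sup>3 - x\<^sup>2 B) = 1\<close>.
\<close>

section \<open>Ordinates and heights\<close>

lemma ordinate_Cons_Suc: "ordinate (s # xs) (Suc i) = rise s + ordinate xs i"
  by (simp add: ordinate_def)

lemma ordinate_append_le: "i \<le> length xs \<Longrightarrow> ordinate (xs @ ys) i = ordinate xs i"
  by (simp add: ordinate_def)

lemma ordinate_append_add:
  "ordinate (xs @ ys) (length xs + i) = ordinate xs (length xs) + ordinate ys i"
  by (simp add: ordinate_def)

lemma ordinate_le_height: "i \<le> length \<gamma> \<Longrightarrow> ordinate \<gamma> i \<le> height \<gamma>"
  unfolding height_def by (rule Max_ge) auto

lemma height_attained: obtains i where "i \<le> length \<gamma>" "ordinate \<gamma> i = height \<gamma>"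
proof -
  have "height \<gamma> \<in> ordinate \<gamma> ` {0..length \<gamma>}"
    unfolding height_def by (rule Max_in) auto
  then show thesis using that by auto
qed

lemma height_eqI:
  assumes "\<And>i. i \<le> length \<gamma> \<Longrightarrow> ordinate \<gamma> i \<le> m"
    and "i \<le> length \<gamma>" "ordinate \<gamma> i = m"
  shows "height \<gamma> = m"
  unfolding height_def by (rule Max_eqI) (use assms in auto)

lemma height_nonneg: "height \<gamma> \<ge> 0"
  using ordinate_le_height[of 0 \<gamma>] by simp

lemma height_Nil [simp]: "height [] = 0"
  by (simp add: height_def)

lemma height_le_length: "height \<gamma> \<le> int (length \<gamma>)"
  by (metis height_attained ordinate_le of_nat_mono order_trans)

text \<open>Since \<alpha> ends on the x-axis, the ordinates of \<beta> reappear unshifted after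
  it.\<close>

lemma height_append:
  assumes "ordinate \<alpha> (length \<alpha>) = 0"
  shows "height (\<alpha> @ \<beta>) = max (height \<alpha>) (height \<beta>)"
proof -
  have bound: "ordinate (\<alpha> @ \<beta>) i \<le> max (height \<alpha>) (height \<beta>)" if i: "i \<le> length (\<alpha> @ \<beta>)" for i
  proof (cases "i \<le> length \<alpha>")
    case True
    then show ?thesis using ordinate_le_height[OF True] by (simp add: ordinate_append_le)
  next
    case False
    then obtain j where j: "i = length \<alpha> + j" by (metis le_Suc_ex nat_le_linear)
    then show ?thesis
      using i ordinate_le_height[of j \<beta>] assms by (simp add: ordinate_append_add)
  qed
  show ?thesis
  proof (cases "height \<beta> \<le> height \<alpha>")
    case True
    obtain i where "i \<le> length \<alpha>" "ordinate \<alpha> i = height \<alpha>" by (rule height_attained)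
    then show ?thesis
      using True bound by (intro height_eqI[of _ _ i]) (auto simp: ordinate_append_le max_def)
  next
    case False
    obtain i where "i \<le> length \<beta>" "ordinate \<beta> i = height \<beta>" by (rule height_attained)
    then show ?thesis
      using False assms bound
      by (intro height_eqI[of _ _ "length \<alpha> + i"]) (auto simp: ordinate_append_add)
  qed
qed

section \<open>Concatenation and final steps of Dyck paths with air pockets\<close>

lemma dap_append:
  assumes a: "dap \<alpha>" and b: "dap \<beta>"
  shows "dap (\<alpha> @ \<beta>)"
  unfolding dap_def
proof (intro conjI allI impI)
  have la: "ordinate \<alpha> (length \<alpha>) = 0" using a by (simp add: dap_def)
  show "\<alpha> @ \<beta> \<noteq> []" using a by (simp add: dap_def)
  show "k \<ge> 1" if "Down k \<in> set (\<alpha> @ \<beta>)" for k using that a b by (auto simp: dap_def)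
  show "ordinate (\<alpha> @ \<beta>) (length (\<alpha> @ \<beta>)) = 0"
    using la b by (simp add: ordinate_append_add dap_def)
  show "ordinate (\<alpha> @ \<beta>) i \<ge> 0" if i: "i \<le> length (\<alpha> @ \<beta>)" for i
  proof (cases "i \<le> length \<alpha>")
    case True
    then show ?thesis using a by (simp add: ordinate_append_le dap_def)
  next
    case False
    then obtain j where j: "i = length \<alpha> + j" by (metis le_Suc_ex nat_le_linear)
    then show ?thesis using i b la by (simp add: ordinate_append_add dap_def)
  qed
  show "\<not> (is_down ((\<alpha> @ \<beta>) ! i) \<and> is_down ((\<alpha> @ \<beta>) ! Suc i))"
    if i: "Suc i < length (\<alpha> @ \<beta>)" for i
  proof -
    consider "Suc i < length \<alpha>" | "Suc i = length \<alpha>" | "length \<alpha> \<le> i" by linarith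
    then show ?thesis
    proof cases
      case 1
      then show ?thesis using a by (simp add: nth_append dap_def)
    next
      \<comment> \<open>At the junction \<beta> begins with \<open>Up\<close> by
        \<open>dap_hd\<close>, so no two down-steps meet.\<close>
      case 2
      then show ?thesis using dap_hd[OF b] by (simp add: nth_append is_down_def)
    next
      case 3
      then obtain j where j: "i = length \<alpha> + j" by (metis le_Suc_ex)
      then show ?thesis using b i
        by (simp add: dap_def flip: add_Suc_right)
    qed
  qed
qed

text \<open>The last step goes from a nonnegative ordinate to 0, so it cannot rise.\<close>

lemma dap_snoc_Down:
  assumes "dap \<delta>"
  obtains \<eta> k where "\<delta> = \<eta> @ [Down k]"
proof -
  from assms have "\<delta> \<noteq> []" by (simp add: dap_def)
  then obtain \<eta> s where d: "\<delta> = \<eta> @ [s]" by (metis rev_exhaust)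
  have "ordinate \<delta> (length \<eta>) \<ge> 0" using assms d by (simp add: dap_def)
  moreover have "ordinate \<delta> (Suc (length \<eta>)) = ordinate \<delta> (length \<eta>) + rise (\<delta> ! length \<eta>)"
    by (rule ordinate_Suc) (simp add: d)
  moreover have "ordinate \<delta> (Suc (length \<eta>)) = 0" using assms d by (simp add: dap_def)
  ultimately have "rise s \<le> 0" using d by simp
  then show thesis using that d by (cases s) auto
qed

lemma dap_length_ge_2:
  assumes "dap \<delta>"
  shows "length \<delta> \<ge> 2"
proof (rule ccontr)
  assume "\<not> ?thesis"
  moreover have "\<delta> \<noteq> []" using assms by (simp add: dap_def)
  ultimately obtain s where s: "\<delta> = [s]" by (cases \<delta>) (auto simp: Suc_le_eq)
  then have "s = Up" using dap_hd[OF assms] by simp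
  then show False using assms s by (simp add: dap_def ordinate_def)
qed

section \<open>The inverse of lowering\<close>

text \<open>The value at \<open>Up\<close> is a default: a DAP always ends in a down-step.\<close>

fun raise_step :: "step \<Rightarrow> step" where
  "raise_step Up = Up"
| "raise_step (Down k) = Down (Suc k)"

text \<open>The empty path is sent to \<open>UD\<close>, the one first return component that cannot be lowered; this
  keeps \<open>height (lift \<delta>) = height \<delta> + 1\<close> for all \<open>\<delta>\<close>, but \<open>length (lift []) = 2\<close>.\<close>

definition lift :: "path \<Rightarrow> path" where
  "lift \<delta> = (if \<delta> = [] then [Up, Down 1] else Up # butlast \<delta> @ [raise_step (last \<delta>)])"

lemma lift_Nil: "lift [] = [Up, Down 1]"
  by (simp add: lift_def)

lemma lift_snoc: "lift (\<eta> @ [Down k]) = Up # \<eta> @ [Down (Suc k)]"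
  by (simp add: lift_def)

lemma length_lift: "\<delta> \<noteq> [] \<Longrightarrow> length (lift \<delta>) = Suc (length \<delta>)"
  by (simp add: lift_def)

lemma lowering_lift: "dap \<delta> \<Longrightarrow> lowering (lift \<delta>) = \<delta>"
  by (erule dap_snoc_Down) (simp add: lift_snoc lowering_def)

lemma lift_lowering:
  assumes "\<alpha> \<in> prime_daps"
  shows "lift (lowering \<alpha>) = \<alpha>"
proof -
  obtain \<beta> k where "k \<ge> 2" and a: "\<alpha> = Up # \<beta> @ [Up, Down k]"
    using prime_dap_shape[OF assms] by blast
  \<comment> \<open>Here \<open>Suc (k - 1) = k\<close>, because \<open>k \<ge> 2\<close> keeps the
    subtraction from truncating.\<close>
  then show ?thesis using lift_snoc[of "\<beta> @ [Up]" "k - 1"] by (simp add: lowering_eq)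
qed

text \<open>The initial \<open>Up\<close> shifts everything by one. The end point is excluded, since
  the enlarged last step returns the path to 0.\<close>

lemma ordinate_lift:
  assumes "dap \<delta>" "i < length \<delta>"
  shows "ordinate (lift \<delta>) (Suc i) = ordinate \<delta> i + 1"
  using assms(1)
proof (rule dap_snoc_Down)
  fix \<eta> k assume "\<delta> = \<eta> @ [Down k]"
  then show ?thesis using assms(2) by (simp add: lift_snoc ordinate_Cons_Suc ordinate_append_le)
qed

lemma ordinate_lift_end:
  assumes "dap \<delta>"
  shows "ordinate (lift \<delta>) (length (lift \<delta>)) = 0"
  using assms
proof (rule dap_snoc_Down)
  fix \<eta> k assume d: "\<delta> = \<eta> @ [Down k]"
  have "ordinate \<delta> (length \<delta>) = 0" using assms by (simp add: dap_def)
  then show ?thesis by (simp add: d lift_snoc ordinate_def)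
qed

lemma ordinate_lift_pos:
  assumes "\<delta> = [] \<or> dap \<delta>" "0 < i" "i < length (lift \<delta>)"
  shows "ordinate (lift \<delta>) i > 0"
proof (cases "\<delta> = []")
  case True
  then have "i = 1" using assms by (simp add: lift_Nil)
  then show ?thesis using True by (simp add: lift_Nil ordinate_def)
next
  case False
  then have d: "dap \<delta>" using assms by simp
  obtain j where j: "i = Suc j" "j < length \<delta>"
    using assms False by (cases i) (auto simp: length_lift)
  then show ?thesis using d by (simp add: ordinate_lift) (simp add: dap_def)
qed

lemma dap_UD: "dap [Up, Down 1]"
  by (auto simp: dap_def ordinate_def is_down_def le_Suc_eq)

lemma dap_lift:
  assumes "\<delta> = [] \<or> dap \<delta>"
  shows "dap (lift \<delta>)"
proof (cases "\<delta> = []")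
  case True
  then show ?thesis by (simp only: lift_Nil dap_UD)
next
  case False
  then have d: "dap \<delta>" using assms by simp
  then obtain \<eta> k where e: "\<delta> = \<eta> @ [Down k]" by (rule dap_snoc_Down)
  show ?thesis
    unfolding dap_def
  proof (intro conjI allI impI)
    show "lift \<delta> \<noteq> []" by (simp add: lift_def)
    show "j \<ge> 1" if "Down j \<in> set (lift \<delta>)" for j
      using that d by (auto simp: e lift_snoc dap_def)
    show end0: "ordinate (lift \<delta>) (length (lift \<delta>)) = 0" using d by (rule ordinate_lift_end)
    show "ordinate (lift \<delta>) i \<ge> 0" if "i \<le> length (lift \<delta>)" for i
      using that end0 ordinate_lift_pos[OF assms, of i]
      by (cases "i = 0"; cases "i = length (lift \<delta>)") auto
    \<comment> \<open>Enlarging the last step preserves its kind; the prepended \<open>Up\<close>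
      shifts indices by one.\<close>
    have down: "is_down (lift \<delta> ! Suc i) \<longleftrightarrow> is_down (\<delta> ! i)" if "i < length \<delta>" for i
      using that by (auto simp: e lift_snoc nth_append is_down_def)
    show "\<not> (is_down (lift \<delta> ! i) \<and> is_down (lift \<delta> ! Suc i))" if "Suc i < length (lift \<delta>)" for i
    proof (cases i)
      case 0
      then show ?thesis by (simp add: e lift_snoc is_down_def)
    next
      case (Suc j)
      then have "Suc j < length \<delta>" using that False by (simp add: length_lift)
      then show ?thesis using d down[of j] down[of "Suc j"] Suc by (simp add: dap_def)
    qed
  qed
qed

lemma height_lift:
  assumes "\<delta> = [] \<or> dap \<delta>"
  shows "height (lift \<delta>) = height \<delta> + 1"
proof (cases "\<delta> = []")
  case True
  have "height [Up, Down 1] = 1"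
    by (rule height_eqI[of _ _ 1]) (auto simp: ordinate_def le_Suc_eq)
  then show ?thesis using True by (simp add: lift_Nil)
next
  case False
  then have d: "dap \<delta>" and len: "length (lift \<delta>) = Suc (length \<delta>)"
    using assms by (simp_all add: length_lift)
  \<comment> \<open>The maximum must be attained before the end point, where
    \<open>ordinate_lift\<close> applies. If it is attained at the end, it is 0 and the starting
    point serves as well.\<close>
  obtain i where i: "i < length \<delta>" "ordinate \<delta> i = height \<delta>"
  proof -
    obtain j where j: "j \<le> length \<delta>" "ordinate \<delta> j = height \<delta>" by (rule height_attained)
    show thesis
    proof (cases "j = length \<delta>")
      case True
      then have "height \<delta> = 0" using j d by (simp add: dap_def)
      then show thesis using that[of 0] False by simp
    next
      case False
      then show thesis using that[of j] j by simp
    qed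
  qed
  show ?thesis
  proof (rule height_eqI[of _ _ "Suc i"])
    fix j assume j: "j \<le> length (lift \<delta>)"
    show "ordinate (lift \<delta>) j \<le> height \<delta> + 1"
    proof (cases j)
      case 0
      then show ?thesis using height_nonneg[of \<delta>] by simp
    next
      case (Suc m)
      show ?thesis
      proof (cases "m = length \<delta>")
        case True
        then show ?thesis
          using ordinate_lift_end[OF d] len Suc height_nonneg[of \<delta>] by simp
      next
        case False
        then show ?thesis
          using j len Suc ordinate_lift[OF d, of m] ordinate_le_height[of m \<delta>] by simp
      qed
    qed
  qed (use i len ordinate_lift[OF d] in auto)
qed

section \<open>Unique first return decomposition\<close>

text \<open>\<open>lift \<delta>\<close> is positive strictly between its end points and 0 at its
  end, so its end is the first return whatever follows.\<close>

lemma first_return_lift_append: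
  assumes "\<delta> = [] \<or> dap \<delta>"
  shows "first_return (lift \<delta> @ \<beta>) = lift \<delta>"
proof -
  have "dap (lift \<delta>)" using assms by (rule dap_lift)
  then have l: "0 < length (lift \<delta>)" "ordinate (lift \<delta>) (length (lift \<delta>)) = 0"
    by (simp_all add: dap_def)
  have "(LEAST i. 0 < i \<and> ordinate (lift \<delta> @ \<beta>) i = 0) = length (lift \<delta>)"
  proof (rule Least_equality)
    show "0 < length (lift \<delta>) \<and> ordinate (lift \<delta> @ \<beta>) (length (lift \<delta>)) = 0"
      using l by (simp add: ordinate_append_le)
    show "length (lift \<delta>) \<le> i" if "0 < i \<and> ordinate (lift \<delta> @ \<beta>) i = 0" for i
      using that ordinate_lift_pos[OF assms, of i]
      by (metis less_irrefl not_le ordinate_append_le less_imp_le)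
  qed
  then show ?thesis by (simp add: first_return_def)
qed

text \<open>\<open>lowering\<close> is a left inverse on DAPs. The empty path is told apart by
  length: \<open>lift []\<close> has 2 steps, the lift of a DAP at least 3.\<close>

lemma lift_inj:
  assumes "\<delta> = [] \<or> dap \<delta>" "\<epsilon> = [] \<or> dap \<epsilon>" "lift \<delta> = lift \<epsilon>"
  shows "\<delta> = \<epsilon>"
proof -
  have "length (lift \<zeta>) \<noteq> 2" if "dap \<zeta>" for \<zeta>
    using dap_length_ge_2[OF that] by (cases "\<zeta> = []") (auto simp: length_lift)
  then have "\<delta> = [] \<longleftrightarrow> \<epsilon> = []"
    using assms by (metis lift_Nil length_Cons list.size(3) numeral_2_eq_2)
  then show ?thesis using assms lowering_lift by metis
qed

lemma H_paths_Nil_or_dap: "\<gamma> \<in> H_paths \<Longrightarrow> \<gamma> = [] \<or> dap \<gamma>"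
  using dap_H_paths by blast

lemma lift_append_in_H_paths:
  assumes d: "\<delta> \<in> H_paths" and b: "\<beta> \<in> H_paths" and h: "height \<beta> \<le> height \<delta> + 1"
  shows "lift \<delta> @ \<beta> \<in> H_paths"
proof (rule H_paths.step)
  note D = H_paths_Nil_or_dap[OF d]
  show "dap (lift \<delta> @ \<beta>)"
    using dap_append[OF dap_lift[OF D]] dap_lift[OF D] dap_H_paths[OF b] by (cases "\<beta> = []") auto
  show "lift \<delta> = first_return (lift \<delta> @ \<beta>)" using first_return_lift_append[OF D] by simp
  show "lift \<delta> \<noteq> [Up, Down 1] \<longrightarrow> lowering (lift \<delta>) \<in> H_paths"
    using D d lowering_lift lift_Nil by metis
  show "height \<beta> \<le> height (lift \<delta>)" using h height_lift[OF D] by simp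
qed (use b in simp_all)

text \<open>Converse of \<open>lift_append_in_H_paths\<close>: a first return component is either
  \<open>UD\<close>, the lift of the empty path, or prime, hence the lift of its lowering.\<close>

lemma H_paths_decompose:
  assumes "\<gamma> \<in> H_paths" "\<gamma> \<noteq> []"
  obtains \<delta> \<beta> where "\<gamma> = lift \<delta> @ \<beta>" "\<delta> \<in> H_paths" "\<beta> \<in> H_paths" "height \<beta> \<le> height \<delta> + 1"
  using assms(1)
proof cases
  case empty
  then show thesis using assms(2) by simp
next
  case (step \<alpha> \<beta>)
  obtain \<delta> where d: "\<alpha> = lift \<delta>" "\<delta> \<in> H_paths"
  proof (cases "\<alpha> = [Up, Down 1]")
    case True
    then show thesis using that[of "[]"] lift_Nil H_paths.empty by metis
  next
    case False
    then have "\<alpha> \<in> prime_daps" using first_return_cases[OF step(1)] step(2) by auto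
    then show thesis using that[of "lowering \<alpha>"] lift_lowering False step(4) by metis
  qed
  then have "height \<alpha> = height \<delta> + 1" by (simp add: height_lift H_paths_Nil_or_dap)
  then show thesis using that[of \<delta> \<beta>] d step by metis
qed

lemma height_lift_append:
  assumes "\<delta> = [] \<or> dap \<delta>" "height \<beta> \<le> height \<delta> + 1"
  shows "height (lift \<delta> @ \<beta>) = height \<delta> + 1"
proof -
  have "ordinate (lift \<delta>) (length (lift \<delta>)) = 0" using dap_lift[OF assms(1)] by (simp add: dap_def)
  then show ?thesis using assms by (simp add: height_append height_lift)
qed

section \<open>Generating functions of sets of lists\<close>

text \<open>Same form as \<open>H_gf\<close>, for arbitrary sets, so that it applies to the height
  classes. As \<open>card\<close> is 0 on infinite sets, the sum and product rules assume finiteness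
  in each length.\<close>

definition list_gf :: "'a list set \<Rightarrow> real fps" where
  "list_gf S = Abs_fps (\<lambda>n. real (card {xs \<in> S. length xs = n}))"

lemma list_gf_nth: "fps_nth (list_gf S) n = real (card {xs \<in> S. length xs = n})"
  by (simp add: list_gf_def)

lemma list_gf_Nil: "list_gf {[]} = 1"
proof (rule fps_ext)
  fix n
  have "{xs \<in> {[]}. length xs = n} = (if n = 0 then {[]} else {})" by auto
  then show "fps_nth (list_gf {[]}) n = fps_nth 1 n"
    by (simp add: list_gf_nth)
qed

lemma list_gf_Un:
  assumes "\<And>n. finite {xs \<in> S. length xs = n}" "\<And>n. finite {xs \<in> T. length xs = n}"
    and "S \<inter> T = {}"
  shows "list_gf (S \<union> T) = list_gf S + list_gf T"
proof (rule fps_ext)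
  fix n
  have "{xs \<in> S \<union> T. length xs = n} = {xs \<in> S. length xs = n} \<union> {xs \<in> T. length xs = n}" by auto
  moreover have "{xs \<in> S. length xs = n} \<inter> {xs \<in> T. length xs = n} = {}" using assms(3) by auto
  ultimately show "fps_nth (list_gf (S \<union> T)) n = fps_nth (list_gf S + list_gf T) n"
    using card_Un_disjoint[OF assms(1)[of n] assms(2)[of n]] by (simp add: list_gf_nth)
qed

lemma list_gf_image:
  assumes "inj_on f S" "\<And>xs. xs \<in> S \<Longrightarrow> length (f xs) = c + length xs"
  shows "list_gf (f ` S) = fps_X ^ c * list_gf S"
proof (rule fps_ext)
  fix n
  show "fps_nth (list_gf (f ` S)) n = fps_nth (fps_X ^ c * list_gf S) n"
  proof (cases "n < c")
    case True
    then have "{xs \<in> f ` S. length xs = n} = {}" using assms(2) by auto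
    then have "card {xs \<in> f ` S. length xs = n} = 0" by (simp only: card.empty)
    then show ?thesis using True by (simp add: list_gf_nth fps_X_power_mult_nth)
  next
    case False
    then have e: "{xs \<in> f ` S. length xs = n} = f ` {xs \<in> S. length xs = n - c}"
      using assms(2) by auto
    have "inj_on f {xs \<in> S. length xs = n - c}" by (rule inj_on_subset[OF assms(1)]) auto
    from card_image[OF this] show ?thesis
      using False by (simp add: list_gf_nth fps_X_power_mult_nth e)
  qed
qed

text \<open>Cauchy product: concatenations of length \<open>n\<close> are sorted by the length of
  the left factor, and injectivity ensures that each is counted once.\<close>

lemma list_gf_append:
  assumes fin: "\<And>n. finite {xs \<in> S. length xs = n}" "\<And>n. finite {xs \<in> T. length xs = n}"
    and inj: "inj_on (\<lambda>(xs, ys). xs @ ys) (S \<times> T)"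
  shows "list_gf ((\<lambda>(xs, ys). xs @ ys) ` (S \<times> T)) = list_gf S * list_gf T"
proof (rule fps_ext)
  fix n
  let ?S = "\<lambda>n. {xs \<in> S. length xs = n}" and ?T = "\<lambda>n. {xs \<in> T. length xs = n}"
  let ?U = "\<Union>i\<in>{0..n}. ?S i \<times> ?T (n - i)"
  have e: "{xs \<in> (\<lambda>(xs, ys). xs @ ys) ` (S \<times> T). length xs = n} = (\<lambda>(xs, ys). xs @ ys) ` ?U"
    (is "?L = ?R")
  proof
    show "?L \<subseteq> ?R"
    proof
      fix zs assume "zs \<in> ?L"
      then obtain xs ys where z: "zs = xs @ ys" "xs \<in> S" "ys \<in> T" "length xs + length ys = n" by auto
      then have "(xs, ys) \<in> ?U" by auto
      then show "zs \<in> ?R" using z(1) by (force intro!: image_eqI[of _ _ "(xs, ys)"])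
    qed
    show "?R \<subseteq> ?L" by force
  qed
  have "card ?L = card ?U"
    unfolding e by (intro card_image inj_on_subset[OF inj]) auto
  also have "\<dots> = (\<Sum>i\<in>{0..n}. card (?S i \<times> ?T (n - i)))"
    by (rule card_UN_disjoint) (use fin in auto)
  also have "\<dots> = (\<Sum>i=0..n. card (?S i) * card (?T (n - i)))"
    by (simp only: card_cartesian_product)
  finally show "fps_nth (list_gf ((\<lambda>(xs, ys). xs @ ys) ` (S \<times> T))) n
      = fps_nth (list_gf S * list_gf T) n"
    by (simp add: list_gf_nth fps_mult_nth)
qed

section \<open>The recurrence in the height\<close>

text \<open>\<open>list_gf\<close> of this set is \<open>A\<^sub>k\<close>; that of
  \<open>H_height_le k\<close> is \<open>B\<^sub>k\<close>.\<close>

definition H_height_eq :: "nat \<Rightarrow> path set" where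
  "H_height_eq k = {\<gamma> \<in> H_paths. height \<gamma> = int k}"

definition H_height_le :: "nat \<Rightarrow> path set" where
  "H_height_le k = {\<gamma> \<in> H_paths. height \<gamma> \<le> int k}"

lemma finite_H_paths_subset_length: "S \<subseteq> H_paths \<Longrightarrow> finite {\<gamma> \<in> S. length \<gamma> = n}"
  by (rule finite_subset[OF _ finite_H_paths_length[of n]]) auto

lemma finite_H_height_length:
  "finite {\<gamma> \<in> H_height_eq k. length \<gamma> = n}" "finite {\<gamma> \<in> H_height_le k. length \<gamma> = n}"
  by (rule finite_H_paths_subset_length; auto simp: H_height_eq_def H_height_le_def)+

lemma height_H_paths_pos: "\<gamma> \<in> H_paths \<Longrightarrow> \<gamma> \<noteq> [] \<Longrightarrow> height \<gamma> \<ge> 1"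
  by (erule (1) H_paths_decompose)
    (simp add: height_lift_append H_paths_Nil_or_dap height_nonneg)

lemma H_height_eq_0: "H_height_eq 0 = {[]}"
  using height_H_paths_pos H_paths.empty by (fastforce simp: H_height_eq_def)

lemma H_height_le_0: "H_height_le 0 = {[]}"
  using height_H_paths_pos H_paths.empty by (fastforce simp: H_height_le_def)

lemma H_height_le_Suc: "H_height_le (Suc k) = H_height_le k \<union> H_height_eq (Suc k)"
  by (auto simp: H_height_eq_def H_height_le_def)

text \<open>The height of \<open>lift \<delta> @ \<beta>\<close> is
  \<open>height \<delta> + 1\<close>, so fixing it fixes the height of \<delta>. The bound on
  \<beta> then no longer varies with \<delta>, and the set of pairs is a full product.\<close>

lemma H_height_eq_Suc:
  "H_height_eq (Suc k) = (\<lambda>(xs, ys). xs @ ys) ` (lift ` H_height_eq k \<times> H_height_le (Suc k))"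
  (is "?L = ?R")
proof
  show "?L \<subseteq> ?R"
  proof
    fix \<gamma> assume "\<gamma> \<in> ?L"
    then have g: "\<gamma> \<in> H_paths" "height \<gamma> = int k + 1" by (auto simp: H_height_eq_def)
    then have "\<gamma> \<noteq> []" by auto
    with g(1) obtain \<delta> \<beta>
      where *: "\<gamma> = lift \<delta> @ \<beta>" "\<delta> \<in> H_paths" "\<beta> \<in> H_paths" "height \<beta> \<le> height \<delta> + 1"
      by (rule H_paths_decompose)
    then have "height \<delta> = int k" using g(2) height_lift_append[of \<delta> \<beta>] H_paths_Nil_or_dap by simp
    then show "\<gamma> \<in> ?R"
      using * by (intro image_eqI[of _ _ "(lift \<delta>, \<beta>)"]) (auto simp: H_height_eq_def H_height_le_def)
  qed
  show "?R \<subseteq> ?L"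
    by (auto simp: H_height_eq_def H_height_le_def height_lift_append H_paths_Nil_or_dap
        lift_append_in_H_paths)
qed

lemma inj_on_lift: "inj_on lift H_paths"
  using lift_inj H_paths_Nil_or_dap by (blast intro: inj_onI)

text \<open>\<open>first_return\<close> recovers the left factor from the concatenation.\<close>

lemma inj_on_lift_append: "inj_on (\<lambda>(xs, ys). xs @ ys) (lift ` H_paths \<times> T)"
proof (rule inj_onI, clarify)
  fix \<delta> \<beta> \<epsilon> \<zeta> assume "\<delta> \<in> H_paths" "\<epsilon> \<in> H_paths" and e: "lift \<delta> @ \<beta> = lift \<epsilon> @ \<zeta>"
  then have "lift \<delta> = lift \<epsilon>"
    using first_return_lift_append[of \<delta> \<beta>] first_return_lift_append[of \<epsilon> \<zeta>] H_paths_Nil_or_dap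
    by metis
  then show "lift \<delta> = lift \<epsilon> \<and> \<beta> = \<zeta>" using e by simp
qed

lemma list_gf_H_height_le_0: "list_gf (H_height_le 0) = 1"
  by (simp add: H_height_le_0 list_gf_Nil)

lemma list_gf_H_height_le_Suc:
  "list_gf (H_height_le (Suc k)) = list_gf (H_height_le k) + list_gf (H_height_eq (Suc k))"
  unfolding H_height_le_Suc
  by (intro list_gf_Un finite_H_height_length) (auto simp: H_height_eq_def H_height_le_def)

lemma list_gf_H_height_eq_Suc_lift:
  "list_gf (H_height_eq (Suc k)) = list_gf (lift ` H_height_eq k) * list_gf (H_height_le (Suc k))"
  unfolding H_height_eq_Suc
proof (rule list_gf_append)
  have sub: "H_height_eq k \<subseteq> H_paths" by (auto simp: H_height_eq_def)
  show "inj_on (\<lambda>(xs, ys). xs @ ys) (lift ` H_height_eq k \<times> H_height_le (Suc k))"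
    by (rule inj_on_subset[OF inj_on_lift_append]) (use sub in auto)
  have "lift \<delta> \<in> H_paths" if "\<delta> \<in> H_paths" for \<delta>
    using lift_append_in_H_paths[OF that H_paths.empty] height_nonneg[of \<delta>] by simp
  then show "finite {\<gamma> \<in> lift ` H_height_eq k. length \<gamma> = n}" for n
    using sub by (intro finite_H_paths_subset_length) auto
qed (rule finite_H_height_length)

text \<open>The only path of height 0 is empty, and its lift \<open>UD\<close> has two steps; hence
  \<open>fps_X ^ 2\<close>.\<close>

lemma list_gf_H_height_eq_1:
  "list_gf (H_height_eq (Suc 0)) = fps_X ^ 2 * list_gf (H_height_le (Suc 0))"
proof -
  have "list_gf (lift ` {[]}) = fps_X ^ 2 * list_gf ({[]} :: path set)"
    by (rule list_gf_image) (auto simp: lift_Nil)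
  then show ?thesis
    by (simp only: list_gf_H_height_eq_Suc_lift H_height_eq_0 list_gf_Nil mult_1_right)
qed

text \<open>Paths of height \<open>Suc k\<close> are nonempty, so lifting adds exactly one step;
  hence the single factor \<open>fps_X\<close>.\<close>

lemma list_gf_H_height_eq_Suc_Suc:
  "list_gf (H_height_eq (Suc (Suc k))) =
    fps_X * list_gf (H_height_eq (Suc k)) * list_gf (H_height_le (Suc (Suc k)))"
proof -
  have "list_gf (lift ` H_height_eq (Suc k)) = fps_X ^ 1 * list_gf (H_height_eq (Suc k))"
  proof (rule list_gf_image)
    show "inj_on lift (H_height_eq (Suc k))"
      by (rule inj_on_subset[OF inj_on_lift]) (auto simp: H_height_eq_def)
    show "length (lift \<delta>) = 1 + length \<delta>" if "\<delta> \<in> H_height_eq (Suc k)" for \<delta>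
      using that by (cases "\<delta> = []") (auto simp: length_lift H_height_eq_def)
  qed
  then show ?thesis by (simp add: list_gf_H_height_eq_Suc_lift)
qed

lemma list_gf_H_height_le_invariant:
  "list_gf (H_height_le (Suc (Suc k))) * (1 - fps_X ^ 3 - fps_X ^ 2 * list_gf (H_height_le k)) = 1"
proof (induction k)
  define b1 where "b1 = list_gf (H_height_le (Suc 0))"
  define b2 where "b2 = list_gf (H_height_le (Suc (Suc 0)))"
  define x :: "real fps" where "x = fps_X"
  case 0
  have b1: "b1 = 1 + x ^ 2 * b1"
    unfolding b1_def x_def
    using list_gf_H_height_le_Suc[of 0] list_gf_H_height_eq_1 list_gf_H_height_le_0 by simp
  have b2: "b2 = b1 + x * (x ^ 2 * b1) * b2"
    unfolding b1_def b2_def x_def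
    using list_gf_H_height_le_Suc[of "Suc 0"] list_gf_H_height_eq_1 list_gf_H_height_eq_Suc_Suc[of 0]
    by simp
  \<comment> \<open>Formally, \<open>1 / b1 = 1 - x^2\<close> and
    \<open>1 / b2 = 1 / b1 - x^3\<close>.\<close>
  have "b2 * (1 - x ^ 3 - x ^ 2 * 1) = 1"
    using b1 b2 by algebra
  then show ?case by (simp add: b2_def x_def list_gf_H_height_le_0)
next
  case (Suc k)
  define b0 where "b0 = list_gf (H_height_le k)"
  define b1 where "b1 = list_gf (H_height_le (Suc k))"
  define b2 where "b2 = list_gf (H_height_le (Suc (Suc k)))"
  define b3 where "b3 = list_gf (H_height_le (Suc (Suc (Suc k))))"
  define a1 where "a1 = list_gf (H_height_eq (Suc k))"
  define x :: "real fps" where "x = fps_X"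
  have e: "b1 = b0 + a1" "b2 * (1 - x ^ 3 - x ^ 2 * b0) = 1" "b3 = b2 + x * (x * a1 * b2) * b3"
    unfolding b0_def b1_def b2_def b3_def a1_def x_def
    using list_gf_H_height_le_Suc list_gf_H_height_eq_Suc_Suc Suc by metis+
  \<comment> \<open>Dividing the third equation of \<open>e\<close> by \<open>b2 * b3\<close> gives
    \<open>1 / b3 = 1 / b2 - x^2 * a1\<close>, and \<open>a1 = b1 - b0\<close>.\<close>
  have "b3 * (1 - x ^ 3 - x ^ 2 * b1) = 1"
    using e by algebra
  then show ?case by (simp add: b3_def b1_def x_def)
qed

section \<open>The quadratic equation\<close>

text \<open>A path of length \<open>n\<close> has height at most \<open>n\<close>. This
  coefficientwise stabilization replaces a limit of series.\<close>

lemma H_gf_nth_eq: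
  assumes "n \<le> k"
  shows "fps_nth H_gf n = fps_nth (list_gf (H_height_le k)) n"
proof -
  have "height \<gamma> \<le> int k" if "length \<gamma> = n" for \<gamma>
    using height_le_length[of \<gamma>] that assms by simp
  then have "{\<gamma> \<in> H_paths. length \<gamma> = n} = {\<gamma> \<in> H_height_le k. length \<gamma> = n}"
    by (auto simp: H_height_le_def)
  then show ?thesis by (simp add: H_gf_def list_gf_nth)
qed

lemma fps_mult_nth_cong:
  assumes "\<And>i. i \<le> n \<Longrightarrow> fps_nth f i = fps_nth f' i" "\<And>i. i \<le> n \<Longrightarrow> fps_nth g i = fps_nth g' i"
  shows "fps_nth (f * g) n = fps_nth (f' * g') n"
  unfolding fps_mult_nth by (rule sum.cong) (auto simp: assms)

text \<open>Up to coefficient \<open>n\<close>, \<open>H_gf\<close> agrees with both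
  \<open>B\<^sub>n\<close> and \<open>B\<^sub>n\<^sub>+\<^sub>2\<close>, so the invariant at
  \<open>n\<close> gives that coefficient of the product.\<close>

lemma H_gf_quadratic: "H_gf * (1 - fps_X ^ 3 - fps_X ^ 2 * H_gf) = 1"
proof (rule fps_ext)
  fix n
  have "fps_nth H_gf i = fps_nth (list_gf (H_height_le n)) i"
    "fps_nth H_gf i = fps_nth (list_gf (H_height_le (Suc (Suc n)))) i" if "i \<le> n" for i
    by (rule H_gf_nth_eq; use that in simp)+
  then have "fps_nth (H_gf * (1 - fps_X ^ 3 - fps_X ^ 2 * H_gf)) n = fps_nth
      (list_gf (H_height_le (Suc (Suc n))) * (1 - fps_X ^ 3 - fps_X ^ 2 * list_gf (H_height_le n))) n"
    by (intro fps_mult_nth_cong) (simp_all add: fps_X_power_mult_nth)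
  then show "fps_nth (H_gf * (1 - fps_X ^ 3 - fps_X ^ 2 * H_gf)) n = fps_nth 1 n"
    by (simp only: list_gf_H_height_le_invariant)
qed

lemma sqrt_series_eq: "sqrt_series = 1 - fps_X ^ 3 - 2 * fps_X ^ 2 * H_gf"
proof -
  let ?r = "1 - fps_X ^ 3 - 2 * fps_X ^ 2 * H_gf"
  \<comment> \<open>Completing the square:
    \<open>?r ^ 2 = (1 - x^3)^2 - 4 * x^2 * (B * (1 - x^3 - x^2 * B))\<close>, and the last factor
    is 1.\<close>
  have "sqrt_series ^ 2 = ?r ^ 2"
    using H_gf_quadratic sqrt_series_power2 by algebra
  then consider "sqrt_series = ?r" | "sqrt_series = - ?r"
    by (auto simp: power2_eq_iff)
  then show ?thesis
  proof cases
    \<comment> \<open>Constant terms decide the sign: 1 on the left, -1 on the right.\<close>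
    case 2
    then have "fps_nth sqrt_series 0 = fps_nth (- ?r) 0" by (rule arg_cong)
    then show ?thesis by (simp add: sqrt_series_nth_0)
  qed
qed

theorem theorem8:
  shows "fps_to_fls H_gf =
           (1 - fls_X ^ 3 - fps_to_fls sqrt_series) / (2 * fls_X ^ 2)"
proof -
  have "fps_to_fls sqrt_series = 1 - fls_X ^ 3 - 2 * fls_X ^ 2 * fps_to_fls H_gf"
    unfolding sqrt_series_eq
    by (simp add: fls_times_fps_to_fls fps_to_fls_power fps_X_to_fls)
  then have "1 - fls_X ^ 3 - fps_to_fls sqrt_series = (2 * fls_X ^ 2) * fps_to_fls H_gf"
    by simp
  \<comment> \<open>This factor is not a unit among power series, but it is invertible in the field
    of Laurent series.\<close>
  moreover have "(2 * fls_X ^ 2 :: real fls) \<noteq> 0" by simp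
  ultimately show ?thesis by simp
qed

end
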